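(* Let $\mathcal H_{\mathbb Z}=\bigoplus_{n\ge 0} D_n$ be graded by depth, as described in the context. There is a unique associative product $\sqcup\!\sqcup$ on $\mathcal H_{\mathbb Z}$ with the following properties: <ul> <li>it is graded, i.e. $D_n\sqcup\!\sqcup D_m\subseteq D_{n+m}$;</li> <li>it has unit $\mathbf 1$;</li> <li>$[0]\sqcup\!\sqcup[\vec s]=[0,\vec s]$ for all $k\ge 1$ and $\vec s\in\mathbb Z^k$;</li> <li>$[\vec s]\sqcup\!\sqcup[0]=[0,\vec s]$ for all $k\ge 1$ and $\vec s\in\mathbb Z_{>0}\times\mathbb Z^{k-1}$;</li> <li>$J$ is a differential operator with respect to $\sqcup\!\sqcup$, i.e. $J(a\sqcup\!\sqcup b)=J(a)\sqcup\!\sqcup b+a\sqcup\!\sqcup J(b)$ for all $a,b\in\mathcal H_{\mathbb Z}$.</li> </ul>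
   Context: Let $\mathcal H_{\mathbb Z}$ be the $\mathbb Q$-vector space with basis consisting of a symbol $\mathbf 1$ together with the formal symbols $[s_1,\dots,s_k]$ for all $k\ge 1$ and $(s_1,\dots,s_k)\in\mathbb Z^k$. These symbols carry no componentwise structure. The depth of $[s_1,\dots,s_k]$ is $k$, and the depth of $\mathbf 1$ is $0$. Let $D_n$ be the span of the basis elements of depth $n$, so $D_0=\mathbb Q\mathbf 1$. For $\vec s=(s_1,\dots,s_k)$ and $a\in\mathbb Z$, write $[a,\vec s]:=[a,s_1,\dots,s_k]$. Let $J:\mathcal H_{\mathbb Z}\to\mathcal H_{\mathbb Z}$ be the linear map given by $J([s_1,s_2,\dots,s_k])=[s_1-1,s_2,\dots,s_k]$ for $k\ge1$, and $J(\mathbf 1)=0$. *)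

theory Defs
  imports Complex_Main "HOL-Library.Poly_Mapping"
begin

text \<open>
  The basis symbols of the space are encoded as lists of integers: the empty list stands for the
  symbol \<open>\<one>\<close> and a nonempty list \<open>[s\<^sub>1, \<dots>, s\<^sub>k]\<close> for the symbol of the same name. Elements of the
  space are finitely supported coefficient functions. The type \<^typ>\<open>int list\<close> carries no monoid
  structure here, so no ring multiplication on the space is inherited from the library.
\<close>

type_synonym HZ = "int list \<Rightarrow>\<^sub>0 rat"

definition symb :: "int list \<Rightarrow> HZ" where
  "symb w = Poly_Mapping.single w 1"

definition scale :: "rat \<Rightarrow> HZ \<Rightarrow> HZ" where
  "scale c x = Poly_Mapping.map ((*) c) x"

lemma lookup_scale [simp]: "Poly_Mapping.lookup (scale c x) w = c * Poly_Mapping.lookup x w"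
  unfolding scale_def by (simp add: Poly_Mapping.map.rep_eq Poly_Mapping.when_def)

global_interpretation HZ: vector_space scale
  by unfold_locales (auto intro!: poly_mapping_eqI simp: lookup_add algebra_simps)

definition depth_part :: "nat \<Rightarrow> HZ set" where
  "depth_part n = HZ.span (symb ` {w. length w = n})"

fun J_symb :: "int list \<Rightarrow> HZ" where
  "J_symb [] = 0"
| "J_symb (s # w) = symb ((s - 1) # w)"

text \<open>The linear extension of \<^const>\<open>J_symb\<close>; see \<open>linear_J\<close> and \<open>J_on_symb\<close> below.\<close>

definition J :: "HZ \<Rightarrow> HZ" where
  "J x = (\<Sum>w\<in>Poly_Mapping.keys x. scale (Poly_Mapping.lookup x w) (J_symb w))"

definition HZ_bilinear :: "(HZ \<Rightarrow> HZ \<Rightarrow> HZ) \<Rightarrow> bool" where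
  "HZ_bilinear m \<longleftrightarrow>
     (\<forall>a. Vector_Spaces.linear scale scale (\<lambda>b. m a b)) \<and>
     (\<forall>b. Vector_Spaces.linear scale scale (\<lambda>a. m a b))"

lemma J_superset:
  assumes "finite A" "Poly_Mapping.keys x \<subseteq> A"
  shows "J x = (\<Sum>w\<in>A. scale (Poly_Mapping.lookup x w) (J_symb w))"
  unfolding J_def using assms
  by (intro sum.mono_neutral_left) (auto simp: in_keys_iff)

lemma linear_J: "Vector_Spaces.linear scale scale J"
proof -
  have "J (x + y) = J x + J y" for x y
  proof -
    let ?A = "Poly_Mapping.keys x \<union> Poly_Mapping.keys y"
    have "Poly_Mapping.keys (x + y) \<subseteq> ?A" by (rule Poly_Mapping.keys_add)
    then have "J (x + y) = (\<Sum>w\<in>?A. scale (Poly_Mapping.lookup (x + y) w) (J_symb w))"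
      by (intro J_superset) auto
    also have "\<dots> = J x + J y"
      by (simp add: J_superset[of ?A x] J_superset[of ?A y] lookup_add
          HZ.scale_left_distrib sum.distrib)
    finally show ?thesis .
  qed
  moreover have "J (scale c x) = scale c (J x)" for c x
  proof -
    have "Poly_Mapping.keys (scale c x) \<subseteq> Poly_Mapping.keys x" by (auto simp: in_keys_iff)
    then have "J (scale c x) = (\<Sum>w\<in>Poly_Mapping.keys x. scale (Poly_Mapping.lookup (scale c x) w) (J_symb w))"
      by (intro J_superset) auto
    then show ?thesis by (simp add: J_def HZ.scale_sum_right)
  qed
  ultimately show ?thesis
    by (intro Vector_Spaces.linear.intro module_hom.intro module_hom_axioms.intro
        HZ.vector_space_axioms HZ.module_axioms)
qed

lemma J_on_symb [simp]:
  "J (symb []) = 0" "J (symb (s # w)) = symb ((s - 1) # w)"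
  by (simp_all add: J_def symb_def)

lemma symb_expansion: "x = (\<Sum>w\<in>Poly_Mapping.keys x. scale (Poly_Mapping.lookup x w) (symb w))"
  by (rule poly_mapping_eqI)
     (simp add: lookup_sum symb_def lookup_single Poly_Mapping.when_def in_keys_iff if_distrib cong: if_cong)

lemma span_symb: "HZ.span (range symb) = UNIV"
proof -
  have "(\<Sum>w\<in>Poly_Mapping.keys x. scale (Poly_Mapping.lookup x w) (symb w)) \<in> HZ.span (range symb)" for x
    by (intro HZ.span_sum HZ.span_scale HZ.span_base) auto
  then show ?thesis using symb_expansion by (metis UNIV_eq_I)
qed

lemma inj_symb: "inj symb"
proof (rule injI)
  fix v w
  assume "symb v = symb w"
  then have "Poly_Mapping.lookup (symb v) v = Poly_Mapping.lookup (symb w) v" by simp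
  then show "v = w" by (simp add: symb_def lookup_single Poly_Mapping.when_def split: if_splits)
qed

lemma independent_symb: "\<not> HZ.dependent (range symb)"
proof
  assume "HZ.dependent (range symb)"
  then obtain T u v where T: "finite T" "T \<subseteq> range symb" "v \<in> T" "u v \<noteq> 0"
    and sum0: "(\<Sum>b\<in>T. scale (u b) b) = 0"
    unfolding HZ.dependent_explicit by blast
  from T obtain w where w: "v = symb w" by auto
  have "Poly_Mapping.lookup b w = (if b = v then 1 else 0)" if "b \<in> T" for b
    using that T w inj_symb by (auto simp: symb_def lookup_single Poly_Mapping.when_def)
  then have "(\<Sum>b\<in>T. u b * Poly_Mapping.lookup b w) = (\<Sum>b\<in>T. if b = v then u b else 0)"
    by (intro sum.cong) auto
  moreover have "(\<Sum>b\<in>T. u b * Poly_Mapping.lookup b w) = 0"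
    using arg_cong[OF sum0, of "\<lambda>x. Poly_Mapping.lookup x w"] by (simp add: lookup_sum)
  ultimately show False using T by simp
qed

end

theory Submission
  imports Defs
begin

text \<open>
  Associativity with \<open>[0]\<close> forces multiplication by \<open>[0, u]\<close> on the left, and by \<open>[0, v]\<close> on the
  right of a word with positive head, to be prepending \<open>0\<close> to a product of smaller total depth. Leibniz'
  rule for \<^const>\<open>J\<close>, which is bijective in positive depth, then propagates the product to all other
  heads: downwards from head \<open>0\<close>, and upwards to two positive heads by inverting \<^const>\<open>J\<close>. This
  determines the product on words by a terminating recursion. The associator satisfies Leibniz' rule
  in three arguments, so the same propagation reduces associativity to the case of a zero head.
\<close>

section \<open>Linear maps on the space\<close>

global_interpretation HZ2: vector_space_pair scale scale
  by unfold_locales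

abbreviation HZ_linear :: "(HZ \<Rightarrow> HZ) \<Rightarrow> bool" where
  "HZ_linear \<equiv> Vector_Spaces.linear scale scale"

lemma HZ_linear_iff:
  "HZ_linear f \<longleftrightarrow> (\<forall>x y. f (x + y) = f x + f y) \<and> (\<forall>c x. f (scale c x) = scale c (f x))"
  by (simp add: Vector_Spaces.linear_iff HZ.vector_space_axioms)

lemma HZ_linear_eqI:
  assumes "HZ_linear f" "HZ_linear g" "\<And>w. f (symb w) = g (symb w)"
  shows "f x = g x"
  by (rule HZ2.linear_eq_on[OF assms(1,2), of _ "range symb"]) (use assms(3) in \<open>auto simp: span_symb\<close>)

lemma HZ_linear_eq_on_symb:
  assumes "HZ_linear f" "HZ_linear g" "\<And>w. w \<in> S \<Longrightarrow> f (symb w) = g (symb w)"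
    and "x \<in> HZ.span (symb ` S)"
  shows "f x = g x"
  by (rule HZ2.linear_eq_on[OF assms(1,2,4)]) (use assms(3) in auto)

lemma HZ_linear_maps_span:
  assumes "HZ_linear f" "\<And>w. w \<in> S \<Longrightarrow> f (symb w) \<in> HZ.span T"
    and "x \<in> HZ.span (symb ` S)"
  shows "f x \<in> HZ.span T"
proof -
  have "f x \<in> HZ.span (f ` symb ` S)"
    using HZ2.linear_span_image[OF assms(1)] assms(3) by blast
  also have "\<dots> \<subseteq> HZ.span T"
    by (rule HZ.span_minimal) (use assms(2) in auto)
  finally show ?thesis .
qed

section \<open>Linear extension from words\<close>

definition extend :: "(int list \<Rightarrow> HZ) \<Rightarrow> HZ \<Rightarrow> HZ" where
  "extend f x = (\<Sum>w\<in>Poly_Mapping.keys x. scale (Poly_Mapping.lookup x w) (f w))"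

lemma extend_superset:
  assumes "finite A" "Poly_Mapping.keys x \<subseteq> A"
  shows "extend f x = (\<Sum>w\<in>A. scale (Poly_Mapping.lookup x w) (f w))"
  unfolding extend_def using assms
  by (intro sum.mono_neutral_left) (auto simp: in_keys_iff)

lemma extend_add: "extend f (x + y) = extend f x + extend f y"
proof -
  let ?A = "Poly_Mapping.keys x \<union> Poly_Mapping.keys y"
  have "Poly_Mapping.keys (x + y) \<subseteq> ?A" by (rule Poly_Mapping.keys_add)
  then show ?thesis
    by (simp add: extend_superset[of ?A x] extend_superset[of ?A y] extend_superset[of ?A "x + y"]
        lookup_add HZ.scale_left_distrib sum.distrib)
qed

lemma extend_scale: "extend f (scale c x) = scale c (extend f x)"
proof -
  have "Poly_Mapping.keys (scale c x) \<subseteq> Poly_Mapping.keys x" by (auto simp: in_keys_iff)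
  then show ?thesis
    by (simp add: extend_superset[of "Poly_Mapping.keys x"] HZ.scale_sum_right)
qed

lemma linear_extend: "HZ_linear (extend f)"
  by (simp add: HZ_linear_iff extend_add extend_scale)

lemma extend_symb [simp]: "extend f (symb w) = f w"
  by (simp add: extend_def symb_def)

lemma J_add: "J (x + y) = J x + J y"
  and J_scale: "J (scale c x) = scale c (J x)"
  and J_diff: "J (x - y) = J x - J y"
  using linear_J HZ2.linear_diff[OF linear_J] by (auto simp: HZ_linear_iff)

text \<open>Since \<open>J\<close> kills the empty word, it can be inverted only on
  \<open>pos_depth\<close>; the value \<open>0\<close> at \<open>[]\<close> is a default.\<close>

definition J_inv :: "HZ \<Rightarrow> HZ" where
  "J_inv = extend (\<lambda>w. case w of [] \<Rightarrow> 0 | s # u \<Rightarrow> symb ((s + 1) # u))"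

text \<open>This is what left multiplication by \<open>[0]\<close> must be: the unit law gives its
  value on the empty word, and the axiom on \<open>[0]\<close> gives it on all others.\<close>

definition prepend0 :: "HZ \<Rightarrow> HZ" where
  "prepend0 = extend (\<lambda>w. symb (0 # w))"

lemma linear_J_inv: "HZ_linear J_inv"
  and linear_prepend0: "HZ_linear prepend0"
  by (simp_all add: J_inv_def prepend0_def linear_extend)

lemma J_inv_symb [simp]: "J_inv (symb (s # u)) = symb ((s + 1) # u)"
  by (simp add: J_inv_def)

lemma prepend0_symb [simp]: "prepend0 (symb w) = symb (0 # w)"
  by (simp add: prepend0_def)

section \<open>Subspaces spanned by words\<close>

text \<open>The sum of all parts of positive depth, on which \<open>J\<close> is bijective.\<close>

definition pos_depth :: "HZ set" where
  "pos_depth = HZ.span (symb ` {w. w \<noteq> []})"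

text \<open>Records the possible first letters, because \<open>[0]\<close> may be moved to the front
  from the right only past words with positive head.\<close>

definition heads_in :: "int set \<Rightarrow> HZ set" where
  "heads_in S = HZ.span (symb ` {a # w |a w. a \<in> S})"

lemma depth_part_subset_pos_depth: "n > 0 \<Longrightarrow> depth_part n \<subseteq> pos_depth"
  unfolding depth_part_def pos_depth_def by (intro HZ.span_mono) auto

lemma J_J_inv: "x \<in> pos_depth \<Longrightarrow> J (J_inv x) = x"
  unfolding pos_depth_def
  by (rule HZ_linear_eq_on_symb[where f = "\<lambda>x. J (J_inv x)" and g = "\<lambda>x. x"])
     (use linear_J linear_J_inv in \<open>auto simp: HZ_linear_iff neq_Nil_conv\<close>)

lemma J_inv_J: "x \<in> pos_depth \<Longrightarrow> J_inv (J x) = x"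
  unfolding pos_depth_def
  by (rule HZ_linear_eq_on_symb[where f = "\<lambda>x. J_inv (J x)" and g = "\<lambda>x. x"])
     (use linear_J linear_J_inv in \<open>auto simp: HZ_linear_iff neq_Nil_conv\<close>)

lemma J_eq_0_imp_eq_0: "J x = 0 \<Longrightarrow> x \<in> pos_depth \<Longrightarrow> x = 0"
  using J_inv_J[of x] HZ2.linear_0[OF linear_J_inv] by simp

lemma symb_in_depth_part [simp]: "symb w \<in> depth_part (length w)"
  unfolding depth_part_def by (rule HZ.span_base) auto

lemma J_in_depth_part: "x \<in> depth_part n \<Longrightarrow> J x \<in> depth_part n"
  unfolding depth_part_def
proof (rule HZ_linear_maps_span[OF linear_J])
  fix w :: "int list" assume "w \<in> {w. length w = n}"
  then show "J (symb w) \<in> HZ.span (symb ` {w. length w = n})"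
    by (cases w) (auto intro!: HZ.span_base HZ.span_zero)
qed

lemma J_inv_in_depth_part: "x \<in> depth_part (Suc n) \<Longrightarrow> J_inv x \<in> depth_part (Suc n)"
  unfolding depth_part_def
  by (rule HZ_linear_maps_span[OF linear_J_inv]) (auto intro!: HZ.span_base simp: length_Suc_conv)

lemma prepend0_in_depth_part: "x \<in> depth_part n \<Longrightarrow> prepend0 x \<in> depth_part (Suc n)"
  unfolding depth_part_def
  by (rule HZ_linear_maps_span[OF linear_prepend0]) (auto intro!: HZ.span_base)

lemma depth_part_add: "x \<in> depth_part n \<Longrightarrow> y \<in> depth_part n \<Longrightarrow> x + y \<in> depth_part n"
  and depth_part_diff: "x \<in> depth_part n \<Longrightarrow> y \<in> depth_part n \<Longrightarrow> x - y \<in> depth_part n"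
  unfolding depth_part_def by (rule HZ.span_add HZ.span_diff; assumption)+

lemma heads_in_mono: "S \<subseteq> T \<Longrightarrow> heads_in S \<subseteq> heads_in T"
  unfolding heads_in_def by (intro HZ.span_mono) auto

lemma prepend0_in_heads: "prepend0 x \<in> heads_in {0..}"
proof -
  have "x \<in> HZ.span (symb ` UNIV)" by (simp add: span_symb)
  then show ?thesis unfolding heads_in_def
    by (rule HZ_linear_maps_span[OF linear_prepend0, rotated]) (auto intro!: HZ.span_base)
qed

lemma J_inv_in_heads: "x \<in> heads_in {0..} \<Longrightarrow> J_inv x \<in> heads_in {0<..}"
  unfolding heads_in_def
  by (rule HZ_linear_maps_span[OF linear_J_inv]) (auto intro!: HZ.span_base)

section \<open>The product\<close>

text \<open>Every clause is forced by the axioms. A zero head is split off as a factor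
  \<open>[0]\<close> and brought to the front; a negative head comes from Leibniz' rule at the next
  larger head, solved for the term with the smaller one; for two positive heads the rule is inverted
  through \<open>J_inv\<close>.\<close>

function word_prod :: "int list \<Rightarrow> int list \<Rightarrow> HZ" where
  "word_prod [] v = symb v"
| "word_prod (a # u) [] = symb (a # u)"
| "word_prod (a # u) (b # v) =
    (if a = 0 then prepend0 (word_prod u (b # v))
     else if a < 0 then J (word_prod ((a + 1) # u) (b # v)) - word_prod ((a + 1) # u) ((b - 1) # v)
     else if b = 0 then prepend0 (word_prod (a # u) v)
     else if b < 0 then J (word_prod (a # u) ((b + 1) # v)) - word_prod ((a - 1) # u) ((b + 1) # v)
     else J_inv (word_prod ((a - 1) # u) (b # v) + word_prod (a # u) ((b - 1) # v)))"
  by pat_completeness auto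
termination
  \<comment> \<open>The order is lexicographic: a zero head lowers the total depth, and in the
    clause for \<open>a < 0\<close> the second head may move away from zero because the first moves
    towards it. The value of \<open>hd []\<close> is harmless, as a word becomes empty only when the
    depth drops.\<close>
  by (relation "measures [\<lambda>(u, v). length u + length v, \<lambda>(u, v). nat \<bar>hd u\<bar>, \<lambda>(u, v). nat \<bar>hd v\<bar>]")
     auto

declare word_prod.simps(3) [simp del]

lemma word_prod_Nil_right [simp]: "word_prod u [] = symb u"
  by (cases u) auto

lemma word_prod_zero_left: "word_prod (0 # u) v = prepend0 (word_prod u v)"
  by (cases v) (auto simp: word_prod.simps(3))

lemma word_prod_zero_right: "a > 0 \<Longrightarrow> word_prod (a # u) (0 # v) = prepend0 (word_prod (a # u) v)"
  by (simp add: word_prod.simps(3))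

lemma word_prod_in_depth_part: "word_prod u v \<in> depth_part (length u + length v)"
proof (induction u v rule: word_prod.induct)
  case (3 a u b v)
  then show ?case
    by (subst word_prod.simps(3))
       (auto intro!: depth_part_add depth_part_diff J_in_depth_part J_inv_in_depth_part
          prepend0_in_depth_part)
qed (use symb_in_depth_part[of "_ # _"] in auto)

text \<open>For \<open>a \<le> 0\<close> this is the defining clause at head \<open>a - 1\<close>,
  rearranged; for \<open>a > 0\<close> and \<open>b \<le> 0\<close>, the one at
  \<open>b - 1\<close>. For two positive heads \<open>J\<close> cancels \<open>J_inv\<close>, the
  argument having positive depth.\<close>

lemma J_word_prod:
  "J (word_prod (a # u) (b # v)) = word_prod ((a - 1) # u) (b # v) + word_prod (a # u) ((b - 1) # v)"
proof -
  consider "a \<le> 0" | "a > 0" "b \<le> 0" | "a > 0" "b > 0" by linarith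
  then show ?thesis
  proof cases
    case 1
    then show ?thesis by (simp add: word_prod.simps(3)[of "a - 1"])
  next
    case 2
    then show ?thesis by (simp add: word_prod.simps(3)[of a _ "b - 1"])
  next
    case 3
    let ?x = "word_prod ((a - 1) # u) (b # v) + word_prod (a # u) ((b - 1) # v)"
    have "?x \<in> depth_part (Suc (Suc (length u + length v)))"
      using word_prod_in_depth_part[of "(a - 1) # u" "b # v"]
        word_prod_in_depth_part[of "a # u" "(b - 1) # v"]
      by (intro depth_part_add) auto
    then have "?x \<in> pos_depth" using depth_part_subset_pos_depth by blast
    then show ?thesis using 3 by (simp add: word_prod.simps(3)[of a _ b] J_J_inv)
  qed
qed

text \<open>Needed to move \<open>[0]\<close> past a product. Lowering one head gives a product that
  either begins with \<open>0\<close> or has positive heads by induction, and \<open>J_inv\<close>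
  then raises each first letter by one.\<close>

lemma word_prod_pos_heads:
  "a > 0 \<Longrightarrow> b > 0 \<Longrightarrow> word_prod (a # u) (b # v) \<in> heads_in {0<..}"
proof (induction "nat (a + b)" arbitrary: a b rule: less_induct)
  case less
  have sub: "heads_in {0<..} \<subseteq> heads_in {0..}" by (rule heads_in_mono) auto
  have "word_prod ((a - 1) # u) (b # v) \<in> heads_in {0..}"
  proof (cases "a = 1")
    case True
    then show ?thesis by (simp add: word_prod_zero_left prepend0_in_heads)
  next
    case False
    then show ?thesis using less.hyps[of "a - 1" b] less.prems sub by auto
  qed
  moreover have "word_prod (a # u) ((b - 1) # v) \<in> heads_in {0..}"
  proof (cases "b = 1")
    case True
    then show ?thesis using less.prems by (simp add: word_prod_zero_right prepend0_in_heads)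
  next
    case False
    then show ?thesis using less.hyps[of a "b - 1"] less.prems sub by auto
  qed
  ultimately have "word_prod ((a - 1) # u) (b # v) + word_prod (a # u) ((b - 1) # v) \<in> heads_in {0..}"
    unfolding heads_in_def by (rule HZ.span_add)
  then show ?case using less.prems by (simp add: word_prod.simps(3)[of a _ b] J_inv_in_heads)
qed

section \<open>Bilinear extension of the product\<close>

definition mult :: "HZ \<Rightarrow> HZ \<Rightarrow> HZ" where
  "mult x y = extend (\<lambda>u. extend (word_prod u) y) x"

lemma mult_symb [simp]: "mult (symb u) (symb v) = word_prod u v"
  by (simp add: mult_def)

lemma linear_mult_left: "HZ_linear (\<lambda>x. mult x y)"
  unfolding mult_def by (rule linear_extend)

lemma linear_mult_right: "HZ_linear (\<lambda>y. mult x y)"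
  unfolding mult_def extend_def[of _ x] HZ_linear_iff
  by (simp add: extend_add extend_scale HZ.scale_right_distrib sum.distrib HZ.scale_sum_right
      mult.commute)

lemma bilinear_mult: "HZ_bilinear mult"
  by (simp add: HZ_bilinear_def linear_mult_left linear_mult_right)

lemma bilinear_eqI:
  assumes "HZ_bilinear f" "HZ_bilinear g" "\<And>u v. f (symb u) (symb v) = g (symb u) (symb v)"
  shows "f x y = g x y"
proof -
  have "f (symb u) y = g (symb u) y" for u
    by (rule HZ_linear_eqI[where f = "f (symb u)"]) (use assms in \<open>auto simp: HZ_bilinear_def\<close>)
  with assms(1,2) show ?thesis
    by - (rule HZ_linear_eqI[where f = "\<lambda>x. f x y"], auto simp: HZ_bilinear_def)
qed

lemmas mult_linear_simps =
  linear_mult_left[unfolded HZ_linear_iff, THEN conjunct1, rule_format]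
  linear_mult_left[unfolded HZ_linear_iff, THEN conjunct2, rule_format]
  linear_mult_right[unfolded HZ_linear_iff, THEN conjunct1, rule_format]
  linear_mult_right[unfolded HZ_linear_iff, THEN conjunct2, rule_format]

lemma mult_Nil_left [simp]: "mult (symb []) x = x"
  by (rule HZ_linear_eqI[where f = "mult (symb [])" and g = "\<lambda>x. x"])
     (auto simp: linear_mult_right HZ_linear_iff mult_linear_simps)

lemma mult_Nil_right [simp]: "mult x (symb []) = x"
  by (rule HZ_linear_eqI[where f = "\<lambda>x. mult x (symb [])" and g = "\<lambda>x. x"])
     (auto simp: HZ_linear_iff mult_linear_simps)

lemma mult_in_depth_part:
  assumes "x \<in> depth_part i" "y \<in> depth_part j"
  shows "mult x y \<in> depth_part (i + j)"
proof -
  have "mult (symb u) y \<in> depth_part (i + j)" if "length u = i" for u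
    using assms(2) unfolding depth_part_def
    by (rule HZ_linear_maps_span[OF linear_mult_right, rotated])
       (use that word_prod_in_depth_part[of u] in \<open>auto simp: depth_part_def\<close>)
  then show ?thesis
    using assms(1) unfolding depth_part_def
    by - (rule HZ_linear_maps_span[OF linear_mult_left], auto)
qed

lemma J_mult: "J (mult x y) = mult (J x) y + mult x (J y)"
proof (rule bilinear_eqI[where f = "\<lambda>x y. J (mult x y)"])
  show "HZ_bilinear (\<lambda>x y. J (mult x y))" "HZ_bilinear (\<lambda>x y. mult (J x) y + mult x (J y))"
    by (simp_all add: HZ_bilinear_def HZ_linear_iff mult_linear_simps J_add J_scale
        HZ.scale_right_distrib)
next
  fix u v
  have z: "mult 0 y = 0" "mult y 0 = 0" for y
    using HZ2.linear_0[OF linear_mult_left] HZ2.linear_0[OF linear_mult_right] by auto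
  show "J (mult (symb u) (symb v)) = mult (J (symb u)) (symb v) + mult (symb u) (J (symb v))"
    by (cases u; cases v) (auto simp: J_word_prod z)
qed

section \<open>Associativity\<close>

lemma mult_prepend0_left: "mult (prepend0 x) y = prepend0 (mult x y)"
  by (rule bilinear_eqI[where f = "\<lambda>x y. mult (prepend0 x) y"])
     (use linear_prepend0 in
       \<open>auto simp: HZ_bilinear_def HZ_linear_iff mult_linear_simps word_prod_zero_left\<close>)

text \<open>Positivity of the heads matters: the product of \<open>[-1]\<close> and
  \<open>[0]\<close> is \<open>[-1, 0] - [0, -1]\<close>, not \<open>[0, -1]\<close>.\<close>

lemma mult_prepend0_right:
  assumes "x \<in> heads_in {0<..}"
  shows "mult x (prepend0 y) = prepend0 (mult x y)"
  using assms unfolding heads_in_def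
proof (rule HZ_linear_eq_on_symb[where f = "\<lambda>x. mult x (prepend0 y)", rotated -1])
  fix w :: "int list" assume "w \<in> {a # w |a w. a \<in> {0<..}}"
  then show "mult (symb w) (prepend0 y) = prepend0 (mult (symb w) y)"
    using linear_prepend0
    by - (rule HZ_linear_eqI[where f = "\<lambda>y. mult (symb w) (prepend0 y)"],
      auto simp: HZ_linear_iff mult_linear_simps word_prod_zero_right)
qed (use linear_prepend0 in \<open>auto simp: HZ_linear_iff mult_linear_simps\<close>)

text \<open>An abstract form of the propagation for the associator, with the three heads as indices.
  Vanishing spreads from index zero to negative indices, one coordinate at a time; the remaining
  positive octant follows from injectivity of \<open>J\<close> on \<open>pos_depth\<close>.\<close>

lemma leibniz_vanishing:
  fixes f :: "int \<Rightarrow> int \<Rightarrow> int \<Rightarrow> HZ"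
  assumes leibniz: "\<And>a b c. J (f a b c) = f (a - 1) b c + f a (b - 1) c + f a b (c - 1)"
    and pos: "\<And>a b c. f a b c \<in> pos_depth"
    and zero1: "\<And>b c. f 0 b c = 0"
    and zero2: "\<And>a c. a > 0 \<Longrightarrow> f a 0 c = 0"
    and zero3: "\<And>a b. a > 0 \<Longrightarrow> b > 0 \<Longrightarrow> f a b 0 = 0"
  shows "f a b c = 0"
proof -
  have J0: "J 0 = 0" by (rule HZ2.linear_0[OF linear_J])
  have s1: "\<forall>b c. f a b c = 0" if "a \<le> 0" for a
    using that
  proof (induction a rule: int_le_induct)
    case (step a)
    \<comment> \<open>If \<open>f a\<close> vanishes for all \<open>b\<close> and \<open>c\<close>,
      every other term of the Leibniz identity is zero.\<close>
    have "f (a - 1) b c = 0" for b c using leibniz[of a b c] step by (simp add: J0)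
    then show ?case by blast
  qed (simp add: zero1)
  have s2: "\<forall>a c. f a b c = 0" if "b \<le> 0" for b
    using that
  proof (induction b rule: int_le_induct)
    case base
    then show ?case using s1 zero2 by (metis linorder_not_less)
  next
    case (step b)
    have "f a (b - 1) c = 0" for a c using leibniz[of a b c] step by (simp add: J0)
    then show ?case by blast
  qed
  have s3: "\<forall>a b. f a b c = 0" if "c \<le> 0" for c
    using that
  proof (induction c rule: int_le_induct)
    case base
    then show ?case using s1 s2 zero3 by (metis linorder_not_less)
  next
    case (step c)
    have "f a b (c - 1) = 0" for a b using leibniz[of a b c] step by (simp add: J0)
    then show ?case by blast
  qed
  show ?thesis
  \<comment> \<open>Only positive triples use the induction hypothesis, and for them lowering one
    index really lowers the natural number.\<close>
  proof (induction "nat (a + b + c)" arbitrary: a b c rule: less_induct)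
    case less
    show ?case
    proof (cases "a > 0 \<and> b > 0 \<and> c > 0")
      case True
      then have "J (f a b c) = 0"
        unfolding leibniz using less.hyps[of "a - 1" b c] less.hyps[of a "b - 1" c]
          less.hyps[of a b "c - 1"] by simp
      then show ?thesis using pos by (rule J_eq_0_imp_eq_0)
    next
      case False
      then show ?thesis using s1 s2 s3 by (metis linorder_not_less)
    qed
  qed
qed

text \<open>The induction on total depth supplies associativity once a zero head has been stripped;
  Leibniz' rule carries it to all heads.\<close>

lemma mult_assoc_symb:
  "mult (mult (symb u) (symb v)) (symb w) = mult (symb u) (mult (symb v) (symb w))"
proof (induction "length u + length v + length w" arbitrary: u v w rule: less_induct)
  case less
  show ?case
  proof (cases "u = [] \<or> v = [] \<or> w = []")
    case True
    then show ?thesis by (auto simp del: mult_symb)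
  next
    case False
    then obtain a u' b v' c w' where uvw: "u = a # u'" "v = b # v'" "w = c # w'"
      by (metis neq_Nil_conv)
    \<comment> \<open>The associator with the tails fixed: the heads range over all integers, since
      Leibniz' rule shifts them.\<close>
    define f where "f = (\<lambda>a b c. mult (mult (symb (a # u')) (symb (b # v'))) (symb (c # w'))
      - mult (symb (a # u')) (mult (symb (b # v')) (symb (c # w'))))"
    have "f a b c = 0"
    proof (rule leibniz_vanishing)
      fix a b c
      show "J (f a b c) = f (a - 1) b c + f a (b - 1) c + f a b (c - 1)"
        unfolding f_def J_diff J_mult J_on_symb mult_linear_simps by (simp add: algebra_simps)
      have "f a b c \<in> depth_part (length u + length v + length w)"
        unfolding f_def
        using mult_in_depth_part[OF mult_in_depth_part[OF symb_in_depth_part symb_in_depth_part]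
            symb_in_depth_part, of "a # u'" "b # v'" "c # w'"]
          mult_in_depth_part[OF symb_in_depth_part mult_in_depth_part[OF symb_in_depth_part
            symb_in_depth_part], of "a # u'" "b # v'" "c # w'"]
        by (intro depth_part_diff) (auto simp: uvw add.assoc simp del: mult_symb)
      then show "f a b c \<in> pos_depth"
        using depth_part_subset_pos_depth[of "length u + length v + length w"] uvw by auto
    next
      fix b c
      show "f 0 b c = 0"
        using less[of u' "b # v'" "c # w'"] uvw
        by (simp add: f_def mult_prepend0_left flip: prepend0_symb del: mult_symb)
    next
      fix a c :: int assume "a > 0"
      then have "symb (a # u') \<in> heads_in {0<..}"
        unfolding heads_in_def by (auto intro!: HZ.span_base)
      then show "f a 0 c = 0"
        using less[of "a # u'" v' "c # w'"] uvw
        by (simp add: f_def mult_prepend0_left mult_prepend0_right flip: prepend0_symb del: mult_symb)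
    next
      fix a b :: int assume ab: "a > 0" "b > 0"
      then have "symb (a # u') \<in> heads_in {0<..}" "symb (b # v') \<in> heads_in {0<..}"
        unfolding heads_in_def by (auto intro!: HZ.span_base)
      \<comment> \<open>On the left-bracketed side the zero must pass the whole product of the first
        two factors.\<close>
      moreover have "mult (symb (a # u')) (symb (b # v')) \<in> heads_in {0<..}"
        using ab by (simp add: word_prod_pos_heads)
      ultimately show "f a b 0 = 0"
        using less[of "a # u'" "b # v'" w'] uvw
        by (simp add: f_def mult_prepend0_right flip: prepend0_symb del: mult_symb)
    qed
    then show ?thesis by (simp add: f_def uvw del: mult_symb)
  qed
qed

lemma mult_assoc: "mult (mult x y) z = mult x (mult y z)"
proof -
  have "mult (mult x y) (symb w) = mult x (mult y (symb w))" for w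
    by (rule bilinear_eqI[where f = "\<lambda>x y. mult (mult x y) (symb w)"])
       (auto simp: HZ_bilinear_def HZ_linear_iff mult_linear_simps mult_assoc_symb simp del: mult_symb)
  then show ?thesis
    by - (rule HZ_linear_eqI[where f = "\<lambda>z. mult (mult x y) z"],
      auto simp: HZ_linear_iff mult_linear_simps)
qed

section \<open>Uniqueness\<close>

text \<open>The induction follows the recursion of \<open>word_prod\<close>, deriving each clause
  for \<open>m\<close> from the axioms.\<close>

lemma word_prod_unique:
  assumes bil: "HZ_bilinear m"
    and assoc: "\<And>a b c. m (m a b) c = m a (m b c)"
    and graded: "\<And>i j a b. a \<in> depth_part i \<Longrightarrow> b \<in> depth_part j \<Longrightarrow> m a b \<in> depth_part (i + j)"
    and unit: "\<And>a. m (symb []) a = a" "\<And>a. m a (symb []) = a"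
    and zero_left: "\<And>s w. m (symb [0]) (symb (s # w)) = symb (0 # s # w)"
    and zero_right: "\<And>s w. s > 0 \<Longrightarrow> m (symb (s # w)) (symb [0]) = symb (0 # s # w)"
    and leibniz: "\<And>a b. J (m a b) = m (J a) b + m a (J b)"
  shows "m (symb u) (symb v) = word_prod u v"
proof (induction u v rule: word_prod.induct)
  case (3 a u b v)
  have m0: "m (symb [0]) x = prepend0 x" for x
  proof (rule HZ_linear_eqI[OF _ linear_prepend0])
    show "m (symb [0]) (symb w) = prepend0 (symb w)" for w
      by (cases w) (auto simp: unit zero_left)
  qed (use bil in \<open>simp add: HZ_bilinear_def\<close>)
  have m_J: "J (m (symb (a # u)) (symb (b # v)))
      = m (symb ((a - 1) # u)) (symb (b # v)) + m (symb (a # u)) (symb ((b - 1) # v))" for a b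
    by (simp add: leibniz)
  consider "a = 0" | "a < 0" | "a > 0" "b = 0" | "a > 0" "b < 0" | "a > 0" "b > 0" by linarith
  then show ?case
  proof cases
    case 1
    have "m (symb (0 # u)) (symb (b # v)) = m (symb [0]) (m (symb u) (symb (b # v)))"
      by (simp add: m0 flip: assoc)
    then show ?thesis using 1 "3.IH"(1) by (simp add: word_prod_zero_left m0)
  next
    case 2
    then show ?thesis
      using m_J[of "a + 1" b] "3.IH"(2,3) by (simp add: word_prod.simps(3)[of a _ b])
  next
    case 3
    \<comment> \<open>The factor \<open>[0]\<close> is split off from the right word, exchanged with
      \<open>a # u\<close>, which is allowed as \<open>a > 0\<close>, and then absorbed by
      \<open>prepend0\<close>.\<close>
    have "m (symb (a # u)) (symb (0 # v)) = m (m (symb (a # u)) (symb [0])) (symb v)"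
      by (simp add: assoc m0)
    also have "\<dots> = m (m (symb [0]) (symb (a # u))) (symb v)"
      using 3 by (simp add: zero_left zero_right)
    also have "\<dots> = prepend0 (m (symb (a # u)) (symb v))"
      by (simp add: assoc flip: m0)
    finally show ?thesis using 3 "3.IH"(4) by (simp add: word_prod_zero_right)
  next
    case 4
    then show ?thesis
      using m_J[of a "b + 1"] "3.IH"(5,6) by (simp add: word_prod.simps(3)[of a _ b])
  next
    case 5
    \<comment> \<open>Gradedness enters here: it excludes a multiple of the unit, which
      \<open>J\<close> could not detect.\<close>
    have "m (symb (a # u)) (symb (b # v)) \<in> pos_depth"
      using graded[OF symb_in_depth_part symb_in_depth_part, of "a # u" "b # v"]
        depth_part_subset_pos_depth[of "length (a # u) + length (b # v)"] by auto
    then have "m (symb (a # u)) (symb (b # v)) = J_inv (J (m (symb (a # u)) (symb (b # v))))"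
      by (simp add: J_inv_J)
    then show ?thesis
      using 5 m_J[of a b] "3.IH"(7,8) by (simp add: word_prod.simps(3)[of a _ b])
  qed
qed (simp_all add: unit)

theorem theorem2p5:
  shows "\<exists>!m :: HZ \<Rightarrow> HZ \<Rightarrow> HZ.
     HZ_bilinear m \<and>
     (\<forall>a b c. m (m a b) c = m a (m b c)) \<and>
     (\<forall>i j. \<forall>a\<in>depth_part i. \<forall>b\<in>depth_part j. m a b \<in> depth_part (i + j)) \<and>
     (\<forall>a. m (symb []) a = a \<and> m a (symb []) = a) \<and>
     (\<forall>s w. m (symb [0]) (symb (s # w)) = symb (0 # s # w)) \<and>
     (\<forall>s w. s > 0 \<longrightarrow> m (symb (s # w)) (symb [0]) = symb (0 # s # w)) \<and>
     (\<forall>a b. J (m a b) = m (J a) b + m a (J b))"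
proof (rule ex1I[of _ mult], goal_cases)
  case 1
  show ?case
    using bilinear_mult
    by (simp add: mult_assoc mult_in_depth_part J_mult word_prod_zero_left word_prod_zero_right)
next
  case (2 m)
  then have "m (symb u) (symb v) = mult (symb u) (symb v)" for u v
    unfolding mult_symb by (intro word_prod_unique) blast+
  then show ?case
    using 2 bilinear_mult by - (intro ext, rule bilinear_eqI, auto)
qed

end
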